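(* In the setting of the context, the five-step iteration (A1)--(A5) can be simplified to the following four-step iteration with a single family of multipliers $\alpha=\{\alpha_{xy}^t\}$. (B1) For every $x\in\mathcal{X}$, $$\Pi_x^d(k+1)\in\arg\min_{\Pi_x^d\in\mathcal{F}_x^d}\ -\sum_{t\in\mathcal{T}}\sum_{y\in\mathcal{Y}_x} d_{xy}(\pi_{xy}^{t,d})-\omega_x f_x\Bigl(\sum_{t\in\mathcal{T}}\sum_{y\in\mathcal{Y}_x}\pi_{xy}^{t,d}\Bigr)+\sum_{t\in\mathcal{T}}\sum_{y\in\mathcal{Y}_x}\alpha_{xy}^{t}(k)\pi_{xy}^{t,d}+\frac{\eta}{2}\sum_{t\in\mathcal{T}}\sum_{y\in\mathcal{Y}_x}\bigl(\pi_{xy}^{t,d}-\pi_{xy}^t(k)\bigr)^2 .$$ (B2) For every $y\in\mathcal{Y}$, $$\Pi_y^s(k+1)\in\arg\min_{\Pi_y^s\in\mathcal{F}_y^s}\ -\sum_{t\in\mathcal{T}}\sum_{x\in\mathcal{X}_y}\bigl(s_{xy}(\pi_{xy}^{t,s})-c_{xy}(\pi_{xy}^{t,s})\bigr)-\sum_{t\in\mathcal{T}}\sum_{x\in\mathcal{X}_y}\alpha_{xy}^{t}(k)\pi_{xy}^{t,s}+\frac{\eta}{2}\sum_{t\in\mathcal{T}}\sum_{x\in\mathcal{X}_y}\bigl(\pi_{xy}^t(k)-\pi_{xy}^{t,s}\bigr)^2 .$$ (B3) For every $\{x,y\}\in\mathcal{E}$ and $t\in\mathcal{T}$, $\ \pi_{xy}^t(k+1)=\frac12\bigl(\pi_{xy}^{t,d}(k+1)+\pi_{xy}^{t,s}(k+1)\bigr)$.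 (B4) For every $\{x,y\}\in\mathcal{E}$ and $t\in\mathcal{T}$, $\ \alpha_{xy}^t(k+1)=\alpha_{xy}^t(k)+\frac{\eta}{2}\bigl(\pi_{xy}^{t,d}(k+1)-\pi_{xy}^{t,s}(k+1)\bigr)$. Precisely: if a sequence $(\Pi_d(k),\Pi_s(k),\Pi(k),\alpha^d(k),\alpha^s(k))_{k\ge0}$ satisfies (A1)--(A5) for all $k\ge 0$, then $\alpha^d(k)=\alpha^s(k)$ for all $k\ge 1$, and, with $\alpha(k)$ denoting this common value, (B1)--(B4) hold for all $k\ge 1$ (and also for $k=0$ if $\alpha^d(0)=\alpha^s(0)=:\alpha(0)$). Conversely, if $(\Pi_d(k),\Pi_s(k),\Pi(k),\alpha(k))_{k\ge 0}$ satisfies (B1)--(B4) for all $k\ge 0$, then with $\alpha^d(k)=\alpha^s(k)=\alpha(k)$ it satisfies (A1)--(A5) for all $k\ge0$.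
   Context: Network. $\mathcal{X}=\{1,\dots,|\mathcal{X}|\}$ is a finite set of target nodes, $\mathcal{Y}=\{1,\dots,|\mathcal{Y}|\}$ a finite set of source nodes, and $\mathcal{T}=\{1,\dots,T\}$ a set of time periods. $\mathcal{E}$ is the edge set of a bipartite graph between $\mathcal{X}$ and $\mathcal{Y}$; an edge is written $\{x,y\}$ with $x\in\mathcal{X}$, $y\in\mathcal{Y}$. $\mathcal{X}_y=\{x:\{x,y\}\in\mathcal{E}\}$ and $\mathcal{Y}_x=\{y:\{x,y\}\in\mathcal{E}\}$ are all nonempty. Data. $d_{xy},s_{xy},c_{xy}:\mathbb{R}_+\to\mathbb{R}$ for $\{x,y\}\in\mathcal{E}$ and $f_x:\mathbb{R}_+\to\mathbb{R}$ for $x\in\mathcal{X}$, where $\mathbb{R}_+=[0,\infty)$. The functions $d_{xy},s_{xy},f_x$ are concave and monotonically increasing, and $c_{xy}$ is convex and monotonically increasing. Constants: $\omega_x\ge 0$, $\bar p_x\ge\underline p_x\ge 0$ ($x\in\mathcal{X}$), $\bar q_y\ge\underline q_y\ge 0$ ($y\in\mathcal{Y}$), $\eta>0$. Variables. $\Pi_d=\{\pi_{xy}^{t,d}\}$, $\Pi_s=\{\pi_{xy}^{t,s}\}$, $\Pi=\{\pi_{xy}^t\}$, $\alpha^d=\{\alpha_{xy}^{t,d}\}$, $\alpha^s=\{\alpha_{xy}^{t,s}\}$, $\alpha=\{\alpha_{xy}^t\}$ are real families indexed by $\{x,y\}\in\mathcal{E}$, $t\in\mathcal{T}$. Write $\Pi_x^d=\{\pi_{xy}^{t,d}\}_{y\in\mathcal{Y}_x,t\in\mathcal{T}}$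 for fixed $x$, $\Pi_y^s=\{\pi_{xy}^{t,s}\}_{x\in\mathcal{X}_y,t\in\mathcal{T}}$ for fixed $y$, and $\Pi_{xy}=\{\pi_{xy}^t\}_{t\in\mathcal{T}}$ for a fixed edge ($\Pi_{xy}$ ranges over $\mathbb{R}^{T}$, unconstrained). Constraint sets. $\mathcal{F}_x^d=\{\Pi_x^d:\pi_{xy}^{t,d}\ge 0\ \forall y\in\mathcal{Y}_x,t\in\mathcal{T};\ \underline p_x\le\sum_{t}\sum_{y\in\mathcal{Y}_x}\pi_{xy}^{t,d}\le\bar p_x\}$; $\mathcal{F}_y^s=\{\Pi_y^s:\pi_{xy}^{t,s}\ge 0\ \forall x\in\mathcal{X}_y,t\in\mathcal{T};\ \underline q_y\le\sum_{t}\sum_{x\in\mathcal{X}_y}\pi_{xy}^{t,s}\le\bar q_y\}$. Five-step iteration. (A1) For every $x\in\mathcal{X}$, $$\Pi_x^d(k+1)\in\arg\min_{\Pi_x^d\in\mathcal{F}_x^d}\ -\sum_{t}\sum_{y\in\mathcal{Y}_x} d_{xy}(\pi_{xy}^{t,d})-\omega_x f_x\Bigl(\sum_{t}\sum_{y\in\mathcal{Y}_x}\pi_{xy}^{t,d}\Bigr)+\sum_{t}\sum_{y\in\mathcal{Y}_x}\alpha_{xy}^{t,d}(k)\pi_{xy}^{t,d}+\frac{\eta}{2}\sum_{t}\sum_{y\in\mathcal{Y}_x}\bigl(\pi_{xy}^{t,d}-\pi_{xy}^t(k)\bigr)^2 .$$ (A2) For every $y\in\mathcal{Y}$, $$\Pi_y^s(k+1)\in\arg\min_{\Pi_y^s\in\mathcal{F}_y^s}\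 -\sum_{t}\sum_{x\in\mathcal{X}_y}\bigl(s_{xy}(\pi_{xy}^{t,s})-c_{xy}(\pi_{xy}^{t,s})\bigr)-\sum_{t}\sum_{x\in\mathcal{X}_y}\alpha_{xy}^{t,s}(k)\pi_{xy}^{t,s}+\frac{\eta}{2}\sum_{t}\sum_{x\in\mathcal{X}_y}\bigl(\pi_{xy}^t(k)-\pi_{xy}^{t,s}\bigr)^2 .$$ (A3) For every $\{x,y\}\in\mathcal{E}$, $$\Pi_{xy}(k+1)=\arg\min_{\Pi_{xy}}\ -\sum_{t}\alpha_{xy}^{t,d}(k)\pi_{xy}^t+\sum_{t}\alpha_{xy}^{t,s}(k)\pi_{xy}^t+\frac{\eta}{2}\sum_{t}\bigl(\pi_{xy}^{t,d}(k+1)-\pi_{xy}^t\bigr)^2+\frac{\eta}{2}\sum_{t}\bigl(\pi_{xy}^t-\pi_{xy}^{t,s}(k+1)\bigr)^2 .$$ (A4) For all $t\in\mathcal{T}$, $\{x,y\}\in\mathcal{E}$: $\ \alpha_{xy}^{t,d}(k+1)=\alpha_{xy}^{t,d}(k)+\eta\bigl(\pi_{xy}^{t,d}(k+1)-\pi_{xy}^t(k+1)\bigr)$. (A5) For all $t\in\mathcal{T}$, $\{x,y\}\in\mathcal{E}$: $\ \alpha_{xy}^{t,s}(k+1)=\alpha_{xy}^{t,s}(k)+\eta\bigl(\pi_{xy}^t(k+1)-\pi_{xy}^{t,s}(k+1)\bigr)$. *)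

theory Defs
  imports "HOL-Analysis.Analysis"
begin

text \<open>
  Target and source nodes are numbered independently from 1, so an edge between target \<open>x\<close>
  and source \<open>y\<close> is encoded as the ordered pair \<open>(x, y)\<close>.  The data functions are total, but
  only their values on \<open>{0..}\<close> are constrained or used.
\<close>

record network =
  num_targets :: nat
  num_sources :: nat
  horizon :: nat
  edges :: "(nat \<times> nat) set"
  d_fun :: "nat \<Rightarrow> nat \<Rightarrow> real \<Rightarrow> real"
  s_fun :: "nat \<Rightarrow> nat \<Rightarrow> real \<Rightarrow> real"
  c_fun :: "nat \<Rightarrow> nat \<Rightarrow> real \<Rightarrow> real"
  f_fun :: "nat \<Rightarrow> real \<Rightarrow> real"
  omega :: "nat \<Rightarrow> real"
  p_lo :: "nat \<Rightarrow> real"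
  p_hi :: "nat \<Rightarrow> real"
  q_lo :: "nat \<Rightarrow> real"
  q_hi :: "nat \<Rightarrow> real"
  eta :: real

definition targets :: "network \<Rightarrow> nat set" where
  "targets N = {1..num_targets N}"

definition sources :: "network \<Rightarrow> nat set" where
  "sources N = {1..num_sources N}"

definition periods :: "network \<Rightarrow> nat set" where
  "periods N = {1..horizon N}"

definition targets_of :: "network \<Rightarrow> nat \<Rightarrow> nat set" where
  "targets_of N y = {x. (x, y) \<in> edges N}"

definition sources_of :: "network \<Rightarrow> nat \<Rightarrow> nat set" where
  "sources_of N x = {y. (x, y) \<in> edges N}"

definition valid_network :: "network \<Rightarrow> bool" where
  "valid_network N \<longleftrightarrow>
     edges N \<subseteq> targets N \<times> sources N \<and>
     (\<forall>x\<in>targets N. sources_of N x \<noteq> {}) \<and>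
     (\<forall>y\<in>sources N. targets_of N y \<noteq> {}) \<and>
     (\<forall>(x, y)\<in>edges N.
        concave_on {0..} (d_fun N x y) \<and> mono_on {0..} (d_fun N x y) \<and>
        concave_on {0..} (s_fun N x y) \<and> mono_on {0..} (s_fun N x y) \<and>
        convex_on {0..} (c_fun N x y) \<and> mono_on {0..} (c_fun N x y)) \<and>
     (\<forall>x\<in>targets N. concave_on {0..} (f_fun N x) \<and> mono_on {0..} (f_fun N x)) \<and>
     (\<forall>x\<in>targets N. 0 \<le> omega N x) \<and>
     (\<forall>x\<in>targets N. 0 \<le> p_lo N x \<and> p_lo N x \<le> p_hi N x) \<and>
     (\<forall>y\<in>sources N. 0 \<le> q_lo N y \<and> q_lo N y \<le> q_hi N y) \<and>
     0 < eta N"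

text \<open>
  A real family indexed by edges and periods is a total function of target, source and period;
  its values off the index set are irrelevant to everything below.
\<close>

type_synonym family = "nat \<Rightarrow> nat \<Rightarrow> nat \<Rightarrow> real"

definition family_eq :: "network \<Rightarrow> family \<Rightarrow> family \<Rightarrow> bool" where
  "family_eq N a b \<longleftrightarrow> (\<forall>(x, y)\<in>edges N. \<forall>t\<in>periods N. a x y t = b x y t)"

definition target_feasible :: "network \<Rightarrow> nat \<Rightarrow> (nat \<Rightarrow> nat \<Rightarrow> real) set" where
  "target_feasible N x =
     {p. (\<forall>y\<in>sources_of N x. \<forall>t\<in>periods N. 0 \<le> p y t) \<and>
         p_lo N x \<le> (\<Sum>t\<in>periods N. \<Sum>y\<in>sources_of N x. p y t) \<and>
         (\<Sum>t\<in>periods N. \<Sum>y\<in>sources_of N x. p y t) \<le> p_hi N x}"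

definition source_feasible :: "network \<Rightarrow> nat \<Rightarrow> (nat \<Rightarrow> nat \<Rightarrow> real) set" where
  "source_feasible N y =
     {p. (\<forall>x\<in>targets_of N y. \<forall>t\<in>periods N. 0 \<le> p x t) \<and>
         q_lo N y \<le> (\<Sum>t\<in>periods N. \<Sum>x\<in>targets_of N y. p x t) \<and>
         (\<Sum>t\<in>periods N. \<Sum>x\<in>targets_of N y. p x t) \<le> q_hi N y}"

text \<open>
  In the objectives below, \<open>a\<close> stands for the current multipliers, \<open>z\<close> for the current
  consensus variables \<open>\<Pi>\<close>, and the last argument is the one minimized over.
\<close>

definition target_objective ::
  "network \<Rightarrow> nat \<Rightarrow> (nat \<Rightarrow> nat \<Rightarrow> real) \<Rightarrow> (nat \<Rightarrow> nat \<Rightarrow> real) \<Rightarrow> (nat \<Rightarrow> nat \<Rightarrow> real) \<Rightarrow> real"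
where
  "target_objective N x a z p =
     - (\<Sum>t\<in>periods N. \<Sum>y\<in>sources_of N x. d_fun N x y (p y t))
     - omega N x * f_fun N x (\<Sum>t\<in>periods N. \<Sum>y\<in>sources_of N x. p y t)
     + (\<Sum>t\<in>periods N. \<Sum>y\<in>sources_of N x. a y t * p y t)
     + eta N / 2 * (\<Sum>t\<in>periods N. \<Sum>y\<in>sources_of N x. (p y t - z y t)\<^sup>2)"

definition source_objective ::
  "network \<Rightarrow> nat \<Rightarrow> (nat \<Rightarrow> nat \<Rightarrow> real) \<Rightarrow> (nat \<Rightarrow> nat \<Rightarrow> real) \<Rightarrow> (nat \<Rightarrow> nat \<Rightarrow> real) \<Rightarrow> real"
where
  "source_objective N y a z p =
     - (\<Sum>t\<in>periods N. \<Sum>x\<in>targets_of N y. s_fun N x y (p x t) - c_fun N x y (p x t))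
     - (\<Sum>t\<in>periods N. \<Sum>x\<in>targets_of N y. a x t * p x t)
     + eta N / 2 * (\<Sum>t\<in>periods N. \<Sum>x\<in>targets_of N y. (z x t - p x t)\<^sup>2)"

definition edge_objective ::
  "network \<Rightarrow> (nat \<Rightarrow> real) \<Rightarrow> (nat \<Rightarrow> real) \<Rightarrow> (nat \<Rightarrow> real) \<Rightarrow> (nat \<Rightarrow> real) \<Rightarrow> (nat \<Rightarrow> real) \<Rightarrow> real"
where
  "edge_objective N ad as pd ps p =
     - (\<Sum>t\<in>periods N. ad t * p t)
     + (\<Sum>t\<in>periods N. as t * p t)
     + eta N / 2 * (\<Sum>t\<in>periods N. (pd t - p t)\<^sup>2)
     + eta N / 2 * (\<Sum>t\<in>periods N. (p t - ps t)\<^sup>2)"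

definition target_step :: "network \<Rightarrow> family \<Rightarrow> family \<Rightarrow> family \<Rightarrow> bool" where
  "target_step N a z pd \<longleftrightarrow>
     (\<forall>x\<in>targets N.
        is_arg_min (target_objective N x (a x) (z x)) (\<lambda>p. p \<in> target_feasible N x) (pd x))"

definition source_step :: "network \<Rightarrow> family \<Rightarrow> family \<Rightarrow> family \<Rightarrow> bool" where
  "source_step N a z ps \<longleftrightarrow>
     (\<forall>y\<in>sources N.
        is_arg_min (source_objective N y (\<lambda>x. a x y) (\<lambda>x. z x y))
          (\<lambda>p. p \<in> source_feasible N y) (\<lambda>x. ps x y))"

text \<open>
  The new edge variable is \<^emph>\<open>the\<close> minimizer: it minimizes, and every minimizer has
  the same values on the periods.
\<close>

definition edge_step :: "network \<Rightarrow> family \<Rightarrow> family \<Rightarrow> family \<Rightarrow> family \<Rightarrow> family \<Rightarrow> bool" where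
  "edge_step N ad as pd ps z \<longleftrightarrow>
     (\<forall>(x, y)\<in>edges N.
        is_arg_min (edge_objective N (ad x y) (as x y) (pd x y) (ps x y)) (\<lambda>_. True) (z x y) \<and>
        (\<forall>p. is_arg_min (edge_objective N (ad x y) (as x y) (pd x y) (ps x y)) (\<lambda>_. True) p \<longrightarrow>
           (\<forall>t\<in>periods N. p t = z x y t)))"

definition five_step ::
  "network \<Rightarrow> (nat \<Rightarrow> family) \<Rightarrow> (nat \<Rightarrow> family) \<Rightarrow> (nat \<Rightarrow> family) \<Rightarrow>
   (nat \<Rightarrow> family) \<Rightarrow> (nat \<Rightarrow> family) \<Rightarrow> nat \<Rightarrow> bool"
where
  "five_step N pd ps z ad as k \<longleftrightarrow>
     target_step N (ad k) (z k) (pd (k + 1)) \<and>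
     source_step N (as k) (z k) (ps (k + 1)) \<and>
     edge_step N (ad k) (as k) (pd (k + 1)) (ps (k + 1)) (z (k + 1)) \<and>
     (\<forall>t\<in>periods N. \<forall>(x, y)\<in>edges N.
        ad (k + 1) x y t = ad k x y t + eta N * (pd (k + 1) x y t - z (k + 1) x y t)) \<and>
     (\<forall>t\<in>periods N. \<forall>(x, y)\<in>edges N.
        as (k + 1) x y t = as k x y t + eta N * (z (k + 1) x y t - ps (k + 1) x y t))"

definition four_step ::
  "network \<Rightarrow> (nat \<Rightarrow> family) \<Rightarrow> (nat \<Rightarrow> family) \<Rightarrow> (nat \<Rightarrow> family) \<Rightarrow>
   (nat \<Rightarrow> family) \<Rightarrow> nat \<Rightarrow> bool"
where
  "four_step N pd ps z a k \<longleftrightarrow>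
     target_step N (a k) (z k) (pd (k + 1)) \<and>
     source_step N (a k) (z k) (ps (k + 1)) \<and>
     (\<forall>(x, y)\<in>edges N. \<forall>t\<in>periods N.
        z (k + 1) x y t = 1 / 2 * (pd (k + 1) x y t + ps (k + 1) x y t)) \<and>
     (\<forall>(x, y)\<in>edges N. \<forall>t\<in>periods N.
        a (k + 1) x y t = a k x y t + eta N / 2 * (pd (k + 1) x y t - ps (k + 1) x y t))"

end

theory Submission
  imports Defs
begin

text \<open>
  Completing the square, the objective of (A3) is, up to a constant, \<open>\<eta>\<close> times the squared
  distance to \<open>(\<pi>\<^sup>d + \<pi>\<^sup>s) / 2 + (\<alpha>\<^sup>d - \<alpha>\<^sup>s) / (2 \<eta>)\<close>, which is therefore the unique minimizer.
  Inserting it into (A4) and (A5) makes the two new multipliers equal, whatever the old ones were;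
  once they are equal, the minimizer is the average of \<open>\<pi>\<^sup>d\<close> and \<open>\<pi>\<^sup>s\<close>, and (A4) and (A5) both
  become (B4).
\<close>

definition edge_minimizer ::
  "network \<Rightarrow> (nat \<Rightarrow> real) \<Rightarrow> (nat \<Rightarrow> real) \<Rightarrow> (nat \<Rightarrow> real) \<Rightarrow> (nat \<Rightarrow> real) \<Rightarrow> nat \<Rightarrow> real"
where
  "edge_minimizer N ad as pd ps t = (pd t + ps t) / 2 + (ad t - as t) / (2 * eta N)"

text \<open>The objective is a sum over periods of quadratics in \<open>p t\<close> with leading
  coefficient \<open>eta N\<close>. Expanding each one at its vertex leaves no linear term.\<close>

lemma edge_objective_complete_square:
  assumes "eta N \<noteq> 0"
  shows "edge_objective N ad as pd ps p =
    edge_objective N ad as pd ps (edge_minimizer N ad as pd ps)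
      + eta N * (\<Sum>t\<in>periods N. (p t - edge_minimizer N ad as pd ps t)\<^sup>2)"
proof -
  let ?m = "edge_minimizer N ad as pd ps"
  let ?g = "\<lambda>p t. - (ad t * p t) + as t * p t + eta N / 2 * (pd t - p t)\<^sup>2
    + eta N / 2 * (p t - ps t)\<^sup>2"
  have sum_form: "edge_objective N ad as pd ps q = (\<Sum>t\<in>periods N. ?g q t)" for q
    by (simp add: edge_objective_def sum.distrib sum_negf sum_subtractf sum_distrib_left)
  have "?g p t = ?g ?m t + eta N * (p t - ?m t)\<^sup>2" for t
  proof -
    \<comment> \<open>This is stationarity at the vertex. Solved for \<open>ad t\<close>, with
      \<open>?m t\<close> kept as an atom, it turns the claim into a polynomial identity.\<close>
    have "ad t - as t = eta N * (2 * ?m t - pd t - ps t)"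
      using assms by (simp add: edge_minimizer_def field_simps)
    then have ad: "ad t = as t + eta N * (2 * ?m t - pd t - ps t)"
      by simp
    show ?thesis
      unfolding ad by (simp add: field_simps power2_eq_square)
  qed
  then show ?thesis
    by (simp only: sum_form sum.distrib sum_distrib_left)
qed

text \<open>Since \<open>eta N\<close> is positive, comparing objectives amounts to comparing
  squared distances to \<open>edge_minimizer\<close>, whose least value 0 is attained exactly by
  agreement on all periods.\<close>

lemma is_arg_min_edge_objective_iff:
  assumes "0 < eta N"
  shows "is_arg_min (edge_objective N ad as pd ps) (\<lambda>_. True) p \<longleftrightarrow>
    (\<forall>t\<in>periods N. p t = edge_minimizer N ad as pd ps t)"
proof -
  let ?m = "edge_minimizer N ad as pd ps"
  let ?S = "\<lambda>p. \<Sum>t\<in>periods N. (p t - ?m t)\<^sup>2"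
  have le_iff: "edge_objective N ad as pd ps p \<le> edge_objective N ad as pd ps q \<longleftrightarrow> ?S p \<le> ?S q"
    for p q
    using assms edge_objective_complete_square[of N ad as pd ps p]
      edge_objective_complete_square[of N ad as pd ps q] by simp
  have nonneg: "0 \<le> ?S q" for q
    by (rule sum_nonneg) simp
  have "is_arg_min (edge_objective N ad as pd ps) (\<lambda>_. True) p \<longleftrightarrow> (\<forall>q. ?S p \<le> ?S q)"
    by (simp only: is_arg_min_linorder le_iff simp_thms)
  also have "\<dots> \<longleftrightarrow> ?S p = 0"
  proof
    assume "\<forall>q. ?S p \<le> ?S q"
    then have "?S p \<le> ?S ?m" ..
    then show "?S p = 0"
      using nonneg[of p] by simp
  qed (use nonneg in simp)
  also have "\<dots> \<longleftrightarrow> (\<forall>t\<in>periods N. p t = ?m t)"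
    by (subst sum_nonneg_eq_0_iff) (auto simp: periods_def)
  finally show ?thesis .
qed

lemma edge_step_iff:
  assumes "0 < eta N"
  shows "edge_step N ad as pd ps z \<longleftrightarrow>
    (\<forall>(x, y)\<in>edges N. \<forall>t\<in>periods N.
       z x y t = edge_minimizer N (ad x y) (as x y) (pd x y) (ps x y) t)"
  unfolding edge_step_def is_arg_min_edge_objective_iff[OF assms] by fastforce

lemma family_eq_sym: "family_eq N a b \<Longrightarrow> family_eq N b a"
  by (fastforce simp: family_eq_def)

text \<open>The objective reads multipliers only at edges and periods, which is where
  \<open>family_eq\<close> gives equality.\<close>

lemma target_step_cong:
  assumes "family_eq N a b"
  shows "target_step N a z pd \<longleftrightarrow> target_step N b z pd"
proof -
  have "target_objective N x (a x) (z x) = target_objective N x (b x) (z x)" for x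
    using assms by (auto simp: fun_eq_iff target_objective_def family_eq_def sources_of_def
        intro!: sum.cong)
  then show ?thesis
    by (simp add: target_step_def)
qed

lemma source_step_cong:
  assumes "family_eq N a b"
  shows "source_step N a z ps \<longleftrightarrow> source_step N b z ps"
proof -
  have "source_objective N y (\<lambda>x. a x y) (\<lambda>x. z x y)
    = source_objective N y (\<lambda>x. b x y) (\<lambda>x. z x y)" for y
    using assms by (auto simp: fun_eq_iff source_objective_def family_eq_def targets_of_def
        intro!: sum.cong)
  then show ?thesis
    by (simp add: source_step_def)
qed

text \<open>With \<open>edge_minimizer\<close> inserted for the new \<open>z\<close>, both updates
  give (ad + as) / 2 + eta / 2 * (pd - ps).\<close>

lemma five_step_multipliers_eq:
  assumes "0 < eta N" and "five_step N pd ps z ad as k"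
  shows "family_eq N (ad (k + 1)) (as (k + 1))"
  using assms
  by (fastforce simp: five_step_def edge_step_iff edge_minimizer_def family_eq_def field_simps)

text \<open>Stating a single step as an equivalence lets it serve both directions of the
  theorem.\<close>

lemma five_step_iff_four_step:
  assumes eta: "0 < eta N"
    and now: "family_eq N (a k) (ad k)" "family_eq N (a k) (as k)"
    and after: "family_eq N (a (k + 1)) (ad (k + 1))" "family_eq N (a (k + 1)) (as (k + 1))"
  shows "five_step N pd ps z ad as k \<longleftrightarrow> four_step N pd ps z a k"
proof -
  let ?avg = "\<lambda>x y t. 1 / 2 * (pd (k + 1) x y t + ps (k + 1) x y t)"
  \<comment> \<open>Equal multipliers cancel the term (ad - as) / (2 * eta) of
    \<open>edge_minimizer\<close>.\<close>
  have edge: "edge_step N (ad k) (as k) (pd (k + 1)) (ps (k + 1)) (z (k + 1)) \<longleftrightarrow>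
    (\<forall>(x, y)\<in>edges N. \<forall>t\<in>periods N. z (k + 1) x y t = ?avg x y t)"
    using now by (fastforce simp: edge_step_iff[OF eta] edge_minimizer_def family_eq_def)
  \<comment> \<open>At the average, pd - z = z - ps = (pd - ps) / 2. The average formula may be
    assumed because it is a conjunct of both sides once \<open>edge\<close> is applied.\<close>
  have dual:
    "(ad (k + 1) x y t = ad k x y t + eta N * (pd (k + 1) x y t - z (k + 1) x y t) \<longleftrightarrow>
       a (k + 1) x y t = a k x y t + eta N / 2 * (pd (k + 1) x y t - ps (k + 1) x y t)) \<and>
     (as (k + 1) x y t = as k x y t + eta N * (z (k + 1) x y t - ps (k + 1) x y t) \<longleftrightarrow>
       a (k + 1) x y t = a k x y t + eta N / 2 * (pd (k + 1) x y t - ps (k + 1) x y t))"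
    if "(x, y) \<in> edges N" "t \<in> periods N" "z (k + 1) x y t = ?avg x y t" for x y t
  proof -
    have "ad k x y t = a k x y t" "as k x y t = a k x y t"
      "ad (k + 1) x y t = a (k + 1) x y t" "as (k + 1) x y t = a (k + 1) x y t"
      using now after that(1,2) by (auto simp: family_eq_def)
    then show ?thesis
      unfolding that(3) by (simp add: field_simps)
  qed
  show ?thesis
    unfolding five_step_def four_step_def edge target_step_cong[OF now(1), symmetric]
      source_step_cong[OF now(2), symmetric]
    using dual by fast
qed

theorem proposition2:
  fixes N :: network
  assumes "valid_network N"
  shows
    "(\<forall>(pd :: nat \<Rightarrow> family) (ps :: nat \<Rightarrow> family) (z :: nat \<Rightarrow> family)
       (ad :: nat \<Rightarrow> family) (as :: nat \<Rightarrow> family).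
        (\<forall>k. five_step N pd ps z ad as k) \<longrightarrow>
          (\<forall>k\<ge>1. family_eq N (ad k) (as k)) \<and>
          (\<forall>a :: nat \<Rightarrow> family.
             (\<forall>k\<ge>1. family_eq N (a k) (ad k) \<and> family_eq N (a k) (as k)) \<longrightarrow>
               (\<forall>k\<ge>1. four_step N pd ps z a k) \<and>
               (family_eq N (a 0) (ad 0) \<and> family_eq N (a 0) (as 0) \<longrightarrow>
                  four_step N pd ps z a 0))) \<and>
     (\<forall>(pd :: nat \<Rightarrow> family) (ps :: nat \<Rightarrow> family) (z :: nat \<Rightarrow> family)
       (a :: nat \<Rightarrow> family) (ad :: nat \<Rightarrow> family) (as :: nat \<Rightarrow> family).
        (\<forall>k. four_step N pd ps z a k) \<and>
        (\<forall>k. family_eq N (ad k) (a k) \<and> family_eq N (as k) (a k)) \<longrightarrow>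
          (\<forall>k. five_step N pd ps z ad as k))"
proof (intro conjI allI impI; (elim conjE)?)
  have eta: "0 < eta N"
    using assms by (simp add: valid_network_def)
  {
    fix pd ps z ad as :: "nat \<Rightarrow> family"
    assume five: "\<forall>k. five_step N pd ps z ad as k"
    {
      fix k :: nat
      assume "1 \<le> k"
      \<comment> \<open>Equality at \<open>k\<close> is produced by the step from
        \<open>k - 1\<close>, hence the start at 1.\<close>
      then show "family_eq N (ad k) (as k)"
        using five_step_multipliers_eq[OF eta, of pd ps z ad as "k - 1"] five by simp
    }
    fix a :: "nat \<Rightarrow> family"
    assume a: "\<forall>k\<ge>1. family_eq N (a k) (ad k) \<and> family_eq N (a k) (as k)"
    {
      fix k :: nat
      assume "1 \<le> k"
      then show "four_step N pd ps z a k"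
        using five_step_iff_four_step[OF eta, of a k ad as pd ps z] a five by simp
    }
    \<comment> \<open>No step precedes index 0, so agreement there is assumed; at index 1 it comes
      from \<open>a\<close>.\<close>
    assume "family_eq N (a 0) (ad 0)" "family_eq N (a 0) (as 0)"
    then show "four_step N pd ps z a 0"
      using five_step_iff_four_step[OF eta, of a 0 ad as pd ps z] a five by simp
  }
  fix pd ps z a ad as :: "nat \<Rightarrow> family" and k
  assume four: "\<forall>k. four_step N pd ps z a k"
    and "\<forall>k. family_eq N (ad k) (a k) \<and> family_eq N (as k) (a k)"
  then have "family_eq N (a j) (ad j)" "family_eq N (a j) (as j)" for j
    by (blast intro: family_eq_sym)+
  then show "five_step N pd ps z ad as k"
    using five_step_iff_four_step[OF eta] four by blast
qed

end
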